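(* Let $\mathbb{X}$ be a $2$-dimensional polyhedral Banach space such that the unit sphere of $\mathbb{X}$ is a regular $2r$-sided polygon, and let $n\in\mathbb{N}$. Then the number of facets of the unit ball of $\mathbb{L}(\mathbb{X},\ell_\infty^n)$ is $2rn$, and $|Ext(B_{\mathbb{L}(\mathbb{X},\ell_\infty^n)})|=(2r)^n$.
   Context: All spaces are over $\mathbb{R}$; $\ell_\infty^n$ is $\mathbb{R}^n$ with the maximum norm, $\mathbb{L}(\mathbb{X},\mathbb{Y})$ is the space of bounded linear operators with the operator norm, $B_{\mathbb{Z}}$ is the closed unit ball of $\mathbb{Z}$, and $Ext(A)$ is the set of extreme points of a convex set $A$. A finite-dimensional Banach space is polyhedral if its closed unit ball has only finitely many extreme points. Here $\mathbb{X}$ is regarded as $\mathbb{R}^2$ with a norm, and "regular polygon" refers to Euclidean regularity in $\mathbb{R}^2$ ($2r$ sides, $r\ge 2$). For a finite-dimensional Banach space $\mathbb{Z}$, a proper face of $B_{\mathbb{Z}}$ is a non-empty set of the form $B_{\mathbb{Z}}\cap\delta M$, where $M$ is a closed half-space containing $B_{\mathbb{Z}}$ and $\delta M$ is its boundary; a facet of $B_{\mathbb{Z}}$ is a proper face that is maximal under inclusion among proper faces. *)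

theory Defs
  imports "HOL-Analysis.Analysis"
begin

text \<open>
  \<open>'n linf\<close> is \<open>\<real>\<^sup>n\<close> with the maximum norm, where \<open>n = CARD('n)\<close>. A separate type is needed because
  \<open>real ^ 'n\<close> carries the Euclidean norm.
\<close>

typedef 'n linf = "UNIV :: (real ^ 'n) set" by simp

setup_lifting type_definition_linf

instantiation linf :: (finite) real_vector
begin

lift_definition zero_linf :: "'a linf" is "0 :: real ^ 'a" .
lift_definition plus_linf :: "'a linf \<Rightarrow> 'a linf \<Rightarrow> 'a linf" is "(+)" .
lift_definition minus_linf :: "'a linf \<Rightarrow> 'a linf \<Rightarrow> 'a linf" is "(-)" .
lift_definition uminus_linf :: "'a linf \<Rightarrow> 'a linf" is "uminus" .
lift_definition scaleR_linf :: "real \<Rightarrow> 'a linf \<Rightarrow> 'a linf" is "scaleR" .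

instance
proof
  fix x y z :: "'a linf" and a b :: real
  show "x + y + z = x + (y + z)" "x + y = y + x" "0 + x = x" "- x + x = 0" "x - y = x + - y"
    by (transfer; simp)+
  show "a *\<^sub>R (x + y) = a *\<^sub>R x + a *\<^sub>R y" "(a + b) *\<^sub>R x = a *\<^sub>R x + b *\<^sub>R x"
    "a *\<^sub>R b *\<^sub>R x = (a * b) *\<^sub>R x" "1 *\<^sub>R x = x"
    by (transfer; simp add: algebra_simps)+
qed

end

instantiation linf :: (finite) real_normed_vector
begin

lift_definition norm_linf :: "'a linf \<Rightarrow> real" is "\<lambda>x. Max (range (\<lambda>i. \<bar>x $ i\<bar>))" .

definition dist_linf :: "'a linf \<Rightarrow> 'a linf \<Rightarrow> real"
  where "dist_linf x y = norm (x - y)"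

definition sgn_linf :: "'a linf \<Rightarrow> 'a linf"
  where "sgn_linf x = x /\<^sub>R norm x"

definition uniformity_linf :: "('a linf \<times> 'a linf) filter"
  where "uniformity_linf = (INF e\<in>{0<..}. principal {(x, y). dist x y < e})"

definition open_linf :: "'a linf set \<Rightarrow> bool"
  where "open_linf U \<longleftrightarrow> (\<forall>x\<in>U. \<forall>\<^sub>F (x', y) in uniformity. x' = x \<longrightarrow> y \<in> U)"

instance
proof
  fix x y :: "'a linf" and a :: real
  show "dist x y = norm (x - y)" by (rule dist_linf_def)
  show "sgn x = x /\<^sub>R norm x" by (rule sgn_linf_def)
  show "(uniformity :: ('a linf \<times> 'a linf) filter)
      = (INF e\<in>{0<..}. principal {(x, y). dist x y < e})"
    by (rule uniformity_linf_def)
  show "open U \<longleftrightarrow> (\<forall>x\<in>U. \<forall>\<^sub>F (x', y) in uniformity. x' = x \<longrightarrow> y \<in> U)" for U :: "'a linf set"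
    by (rule open_linf_def)
  show "norm x = 0 \<longleftrightarrow> x = 0"
  proof (transfer, rule iffI)
    fix x :: "real ^ 'a"
    assume *: "Max (range (\<lambda>i. \<bar>x $ i\<bar>)) = 0"
    have "\<bar>x $ i\<bar> \<le> Max (range (\<lambda>i. \<bar>x $ i\<bar>))" for i by (rule Max_ge) auto
    with * show "x = 0" by (simp add: vec_eq_iff)
  qed simp
  show "norm (x + y) \<le> norm x + norm y"
  proof (transfer, rule Max.boundedI; clarsimp)
    fix x y :: "real ^ 'a" and i
    have "\<bar>x $ i\<bar> \<le> Max (range (\<lambda>i. \<bar>x $ i\<bar>))" "\<bar>y $ i\<bar> \<le> Max (range (\<lambda>i. \<bar>y $ i\<bar>))"
      by (rule Max_ge; auto)+
    then show "\<bar>x $ i + y $ i\<bar> \<le> Max (range (\<lambda>i. \<bar>x $ i\<bar>)) + Max (range (\<lambda>i. \<bar>y $ i\<bar>))" by linarith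
  qed
  show "norm (a *\<^sub>R x) = \<bar>a\<bar> * norm x"
  proof transfer
    fix a :: real and x :: "real ^ 'a"
    have "mono ((*) \<bar>a\<bar>)" by (simp add: mono_def mult_left_mono)
    then have "\<bar>a\<bar> * Max (range (\<lambda>i. \<bar>x $ i\<bar>)) = Max ((*) \<bar>a\<bar> ` range (\<lambda>i. \<bar>x $ i\<bar>))"
      by (rule mono_Max_commute) auto
    then show "Max (range (\<lambda>i. \<bar>(a *\<^sub>R x) $ i\<bar>)) = \<bar>a\<bar> * Max (range (\<lambda>i. \<bar>x $ i\<bar>))"
      by (simp add: image_image abs_mult)
  qed
qed

end

definition polyhedral_space :: "'a::real_normed_vector itself \<Rightarrow> bool"
  where "polyhedral_space _ \<longleftrightarrow>
    (\<exists>B :: 'a set. finite B \<and> span B = UNIV) \<and> finite {x :: 'a. x extreme_point_of cball 0 1}"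

definition closed_halfspace :: "'a::real_normed_vector set \<Rightarrow> bool"
  where "closed_halfspace M \<longleftrightarrow>
    (\<exists>(f :: 'a \<Rightarrow> real) c. bounded_linear f \<and> f \<noteq> (\<lambda>_. 0) \<and> M = {z. f z \<le> c})"

text \<open>
  The library's \<open>facet_of\<close> is confined to Euclidean spaces, so it does not apply to operator spaces.
\<close>

definition proper_face_of :: "'a::real_normed_vector set \<Rightarrow> 'a set \<Rightarrow> bool"
  where "proper_face_of F S \<longleftrightarrow>
    F \<noteq> {} \<and> (\<exists>M. closed_halfspace M \<and> S \<subseteq> M \<and> F = S \<inter> frontier M)"

definition is_facet_of :: "'a::real_normed_vector set \<Rightarrow> 'a set \<Rightarrow> bool"
  where "is_facet_of F S \<longleftrightarrow>
    proper_face_of F S \<and> (\<forall>G. proper_face_of G S \<and> F \<subseteq> G \<longrightarrow> G = F)"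

definition polygonal_curve :: "nat \<Rightarrow> (nat \<Rightarrow> real ^ 2) \<Rightarrow> (real ^ 2) set"
  where "polygonal_curve m v = (\<Union>k<m. closed_segment (v k) (v (Suc k mod m)))"

text \<open>
  \<open>v 0, \<dots>, v (m - 1)\<close> are the vertices of a convex polygon, in cyclic order: the extreme point condition
  rules out straight angles, and the frontier condition rules out self-crossing orders of the vertices.
\<close>

definition convex_polygon :: "nat \<Rightarrow> (nat \<Rightarrow> real ^ 2) \<Rightarrow> bool"
  where "convex_polygon m v \<longleftrightarrow>
    3 \<le> m \<and> inj_on v {..<m} \<and>
    (\<forall>k<m. v k extreme_point_of convex hull (v ` {..<m})) \<and>
    polygonal_curve m v = frontier (convex hull (v ` {..<m}))"

definition vertex_angle :: "real ^ 2 \<Rightarrow> real ^ 2 \<Rightarrow> real ^ 2 \<Rightarrow> real"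
  where "vertex_angle a b c = arccos ((a - b) \<bullet> (c - b) / (norm (a - b) * norm (c - b)))"

text \<open>
  Polygons are taken as curves here, not as the regions they bound.
\<close>

definition regular_polygon :: "nat \<Rightarrow> (real ^ 2) set \<Rightarrow> bool"
  where "regular_polygon m P \<longleftrightarrow>
    (\<exists>v. convex_polygon m v \<and> P = polygonal_curve m v \<and>
      (\<exists>s. \<forall>k<m. dist (v k) (v (Suc k mod m)) = s) \<and>
      (\<exists>\<alpha>. \<forall>k<m. vertex_angle (v k) (v (Suc k mod m)) (v (Suc (Suc k) mod m)) = \<alpha>))"

end

theory Submission
  imports Defs
begin

text \<open>
  Let \<open>W\<close> be the set of the \<open>m = 2r\<close> vertices of the polygon \<open>\<phi> ` sphere 0 1\<close>. A finite-dimensional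
  unit ball is recovered from its unit sphere, so \<open>\<phi>\<close> maps the unit ball onto \<open>convex hull W\<close>, and the
  origin lies in the interior of this hull. An operator \<open>T\<close> into \<open>'n linf\<close> is a tuple of functionals
  \<open>x \<mapsto> G $ i \<bullet> \<phi> x\<close>, and it has norm at most one iff every row \<open>G $ i\<close> lies in
  the polar \<open>{g. \<forall>w\<in>W. g \<bullet> w \<le> 1}\<close> (both signs are covered because the ball of the domain is symmetric).
  So the operator ball is at once a product of \<open>n\<close> copies of the polar polygon and the polyhedron given by
  the \<open>n m\<close> inequalities \<open>G $ i \<bullet> w \<le> 1\<close>. The two counts use one description each.

  \<^emph>\<open>Extreme points.\<close> The extreme points of a product are the tuples of extreme points, so it suffices
  that the polar of an \<open>m\<close>-gon has \<open>m\<close> extreme points. These correspond to the edges: in the plane a point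
  of the polar is extreme iff two vertices satisfy their inequality with equality, which forces these two
  to span an edge; conversely a supporting line at the midpoint of an edge supports along the whole
  edge, and no line passes through three vertices
  (\<open>extreme_point_of_polar_iff\<close>, \<open>card_extreme_points_polar_polygon\<close>).

  \<^emph>\<open>Facets.\<close> A proper face of a polyhedron satisfies one of the defining inequalities with equality:
  otherwise an average of points of the face, one for each inequality, would be an interior point of the
  polyhedron at which a non-zero functional is maximal. Hence the facets are the sets on which one
  inequality is an equality, provided that each inequality can be made tight while all others stay strict
  (\<open>card_facets_irredundant_constraints\<close>). For the inequality with index \<open>(i, w)\<close> this is achieved by
  the operator whose only non-zero row is the \<open>i\<close>-th, taken to be a functional exposing the vertex \<open>w\<close>.
\<close>

section \<open>Facets of an intersection of half-spaces\<close>

text \<open>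
  A non-zero functional has no local maximum.
\<close>

lemma less_if_in_interior_halfspace:
  fixes f :: "'a::real_normed_vector \<Rightarrow> real"
  assumes f: "bounded_linear f" "f \<noteq> (\<lambda>_. 0)" and z: "z \<in> interior {z. f z \<le> c}"
  shows "f z < c"
proof -
  interpret bounded_linear f by (rule f(1))
  from f(2) obtain u0 where "f u0 \<noteq> 0" by auto
  then obtain u where u: "f u > 0"
    by (cases "f u0 > 0") (auto intro: that[of u0] that[of "- u0"] simp: neg)
  then have "u \<noteq> 0" by (auto simp: zero)
  from z obtain e where e: "e > 0" "ball z e \<subseteq> {z. f z \<le> c}"
    by (auto simp: mem_interior)
  have "z + (e / (2 * norm u)) *\<^sub>R u \<in> ball z e"
    using \<open>u \<noteq> 0\<close> e(1) by (simp add: dist_norm)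
  with e(2) have "f z + e / (2 * norm u) * f u \<le> c"
    by (auto simp: add scaleR)
  moreover have "e / (2 * norm u) * f u > 0"
    using \<open>u \<noteq> 0\<close> e(1) u by simp
  ultimately show ?thesis by linarith
qed

lemma frontier_halfspace:
  fixes f :: "'a::real_normed_vector \<Rightarrow> real"
  assumes f: "bounded_linear f" "f \<noteq> (\<lambda>_. 0)"
  shows "frontier {z. f z \<le> c} = {z. f z = c}"
proof -
  have cont: "continuous_on UNIV f"
    using f(1) by (simp add: linear_continuous_on)
  have "closed {z. f z \<le> c}"
    by (rule closed_Collect_le[OF cont continuous_on_const])
  moreover have "interior {z. f z \<le> c} = {z. f z < c}"
  proof (rule interior_unique)
    show "open {z. f z < c}"
      by (rule open_Collect_less[OF cont continuous_on_const])
    show "T \<subseteq> {z. f z < c}" if "T \<subseteq> {z. f z \<le> c}" "open T" for T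
      using less_if_in_interior_halfspace[OF f] that by (blast intro: interiorI)
  qed auto
  ultimately show ?thesis by (auto simp: frontier_def)
qed

lemma proper_face_of_iff:
  "proper_face_of F S \<longleftrightarrow> F \<noteq> {} \<and>
    (\<exists>(f :: 'a::real_normed_vector \<Rightarrow> real) c. bounded_linear f \<and> f \<noteq> (\<lambda>_. 0) \<and> (\<forall>z\<in>S. f z \<le> c) \<and> F = {z \<in> S. f z = c})"
  (is "_ \<longleftrightarrow> _ \<and> ?R")
proof -
  have "(\<exists>M. closed_halfspace M \<and> S \<subseteq> M \<and> F = S \<inter> frontier M) \<longleftrightarrow> ?R" (is "?L \<longleftrightarrow> _")
  proof
    assume ?L
    then obtain f :: "'a \<Rightarrow> real" and c where f: "bounded_linear f" "f \<noteq> (\<lambda>_. 0)" and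
      M: "S \<subseteq> {z. f z \<le> c}" "F = S \<inter> frontier {z. f z \<le> c}"
      unfolding closed_halfspace_def by blast
    then show ?R
      unfolding frontier_halfspace[OF f, of c]
      by (intro exI[of _ f] exI[of _ c]) (use f in blast)
  next
    assume ?R
    then obtain f :: "'a \<Rightarrow> real" and c where f: "bounded_linear f" "f \<noteq> (\<lambda>_. 0)" and
      M: "\<forall>z\<in>S. f z \<le> c" "F = {z \<in> S. f z = c}"
      by blast
    then show ?L
      unfolding closed_halfspace_def using f frontier_halfspace[OF f, of c]
      by (intro exI[of _ "{z. f z \<le> c}"]) blast
  qed
  then show ?thesis by (simp only: proper_face_of_def)
qed

text \<open>
  If no constraint were tight on all of \<open>G\<close>, there would be a point of \<open>G\<close> for each constraint at which
  that constraint is strict. Their average satisfies all constraints strictly, hence is interior, yet the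
  functional that defines \<open>G\<close> attains its maximum there.
\<close>

lemma proper_face_subset_constraint_face:
  fixes f :: "'i \<Rightarrow> 'a::real_normed_vector \<Rightarrow> real"
  assumes A: "finite A" "A \<noteq> {}" and lin: "\<And>a. a \<in> A \<Longrightarrow> bounded_linear (f a)"
    and G: "proper_face_of G {z. \<forall>a\<in>A. f a z \<le> 1}"
  shows "\<exists>a\<in>A. \<forall>z\<in>G. f a z = 1"
proof (rule ccontr)
  let ?S = "{z. \<forall>a\<in>A. f a z \<le> 1}"
  assume contra: "\<not> ?thesis"
  from G obtain g :: "'a \<Rightarrow> real" and c where g: "bounded_linear g" "g \<noteq> (\<lambda>_. 0)"
    and S: "\<forall>z\<in>?S. g z \<le> c" and G_eq: "G = {z \<in> ?S. g z = c}"
    unfolding proper_face_of_iff by (elim conjE exE)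
  from contra have "\<forall>a\<in>A. \<exists>z. z \<in> G \<and> f a z \<noteq> 1" by blast
  then obtain Z where Z: "\<And>a. a \<in> A \<Longrightarrow> Z a \<in> G" "\<And>a. a \<in> A \<Longrightarrow> f a (Z a) \<noteq> 1"
    by metis
  define z where "z = (1 / card A) *\<^sub>R (\<Sum>a\<in>A. Z a)"
  have card: "real (card A) > 0" using A by (simp add: card_gt_0_iff)
  have strict: "f b z < 1" if b: "b \<in> A" for b
  proof -
    interpret bounded_linear "f b" by (rule lin[OF b])
    have "(\<Sum>a\<in>A. f b (Z a)) < (\<Sum>a\<in>A. 1)"
    proof (rule sum_strict_mono_ex1[OF A(1)])
      show le: "\<forall>a\<in>A. f b (Z a) \<le> 1" using Z(1) b unfolding G_eq by blast
      have "f b (Z b) < 1" using bspec[OF le b] Z(2)[OF b] by simp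
      with b show "\<exists>a\<in>A. f b (Z a) < 1" by blast
    qed
    then show ?thesis
      using card by (simp add: z_def scaleR sum field_simps)
  qed
  have "open (\<Inter>a\<in>A. {z. f a z < 1})"
    using A(1) lin
    by (intro open_INT ballI open_Collect_less linear_continuous_on continuous_on_const) auto
  moreover have "(\<Inter>a\<in>A. {z. f a z < 1}) \<subseteq> {z. g z \<le> c}"
  proof
    fix z assume "z \<in> (\<Inter>a\<in>A. {z. f a z < 1})"
    then have "z \<in> ?S" by (simp add: less_imp_le)
    with S show "z \<in> {z. g z \<le> c}" by blast
  qed
  ultimately have "z \<in> interior {z. g z \<le> c}"
    using strict by (intro interiorI) auto
  then have "g z < c" by (rule less_if_in_interior_halfspace[OF g])
  moreover have "g z = c"
  proof -
    interpret bounded_linear g by (rule g(1))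
    have "(\<Sum>a\<in>A. g (Z a)) = (\<Sum>a\<in>A. c)"
      by (rule sum.cong) (use Z(1) in \<open>simp_all add: G_eq\<close>)
    then show ?thesis using card by (simp add: z_def scaleR sum)
  qed
  ultimately show False by simp
qed

text \<open>
  Every proper face lies in one of the sets \<open>F a\<close> on which the constraint \<open>a\<close> is tight, and irredundancy
  makes the sets \<open>F a\<close> pairwise incomparable; so they are exactly the maximal proper faces.
\<close>

lemma card_facets_irredundant_constraints:
  fixes f :: "'i \<Rightarrow> 'a::real_normed_vector \<Rightarrow> real"
  assumes A: "finite A" "A \<noteq> {}" and lin: "\<And>a. a \<in> A \<Longrightarrow> bounded_linear (f a)"
    and irred: "\<And>a. a \<in> A \<Longrightarrow> \<exists>z. f a z = 1 \<and> (\<forall>b\<in>A - {a}. f b z < 1)"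
  shows "card {F. is_facet_of F {z. \<forall>a\<in>A. f a z \<le> 1}} = card A"
proof -
  let ?S = "{z. \<forall>a\<in>A. f a z \<le> 1}"
  define F where "F a = {z \<in> ?S. f a z = 1}" for a
  have witness: "\<exists>z. z \<in> F a \<and> (\<forall>b\<in>A - {a}. z \<notin> F b)" if a: "a \<in> A" for a
  proof -
    from irred[OF a] obtain z where z: "f a z = 1" "\<forall>b\<in>A - {a}. f b z < 1"
      by blast
    have "f b z \<le> 1" if "b \<in> A" for b
      using z that by (cases "b = a") (auto simp: less_imp_le)
    then have "z \<in> F a" using z(1) by (simp add: F_def)
    moreover have "z \<notin> F b" if "b \<in> A - {a}" for b
      using bspec[OF z(2) that] by (simp add: F_def)
    ultimately show ?thesis by blast
  qed
  have inj: "a = b" if "a \<in> A" "b \<in> A" "F a \<subseteq> F b" for a b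
    using witness[OF that(1)] that by blast
  have face: "proper_face_of (F a) ?S" if a: "a \<in> A" for a
  proof -
    have "F a \<noteq> {}" using witness[OF a] by blast
    moreover from this have "f a \<noteq> (\<lambda>_. 0)" by (auto simp: F_def)
    ultimately show ?thesis
      unfolding proper_face_of_iff using a lin
      by (intro conjI exI[of _ "f a"] exI[of _ 1]) (simp_all add: F_def)
  qed
  have below: "\<exists>a\<in>A. G \<subseteq> F a" if G: "proper_face_of G ?S" for G
  proof -
    have "G \<subseteq> ?S" using G unfolding proper_face_of_iff by blast
    moreover obtain a where "a \<in> A" "\<forall>z\<in>G. f a z = 1"
      using proper_face_subset_constraint_face[OF A lin G] by blast
    ultimately show ?thesis unfolding F_def by blast
  qed
  have "{G. is_facet_of G ?S} = F ` A"
  proof (intro equalityI subsetI)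
    fix G assume "G \<in> {G. is_facet_of G ?S}"
    then have G: "proper_face_of G ?S" "\<And>H. proper_face_of H ?S \<Longrightarrow> G \<subseteq> H \<Longrightarrow> H = G"
      by (auto simp: is_facet_of_def)
    from below[OF G(1)] obtain a where "a \<in> A" "G \<subseteq> F a" by blast
    with G(2)[OF face] show "G \<in> F ` A" by blast
  next
    fix G assume "G \<in> F ` A"
    then obtain a where a: "a \<in> A" "G = F a" by blast
    have "H = F a" if H: "proper_face_of H ?S" "F a \<subseteq> H" for H
    proof -
      from below[OF H(1)] obtain b where "b \<in> A" "H \<subseteq> F b" by blast
      with inj[OF a(1)] H(2) show ?thesis by blast
    qed
    then show "G \<in> {G. is_facet_of G ?S}"
      unfolding is_facet_of_def a(2) using face[OF a(1)] by blast
  qed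
  moreover have "inj_on F A" by (rule inj_onI) (simp add: inj)
  ultimately show ?thesis by (simp add: card_image)
qed

section \<open>Extreme points of products\<close>

text \<open>
  A segment in one component lifts to a segment of vectors that agree in the other components, and a
  segment of vectors is non-degenerate in some component.
\<close>

lemma extreme_point_of_vec_iff:
  fixes x :: "'a::real_vector ^ 'n"
  shows "x extreme_point_of {y. \<forall>i. y $ i \<in> S} \<longleftrightarrow> (\<forall>i. x $ i extreme_point_of S)"
proof
  assume x: "x extreme_point_of {y. \<forall>i. y $ i \<in> S}"
  show "\<forall>i. x $ i extreme_point_of S"
  proof
    fix i
    have False if ab: "a \<in> S" "b \<in> S" "x $ i \<in> open_segment a b" for a b
    proof -
      define p where "p c = (\<chi> j. if j = i then c else x $ j)" for c
      from ab(3) obtain t where t: "a \<noteq> b" "0 < t" "t < 1" "x $ i = (1 - t) *\<^sub>R a + t *\<^sub>R b"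
        unfolding in_segment by blast
      have "x = (1 - t) *\<^sub>R p a + t *\<^sub>R p b"
        using t(4) by (simp add: vec_eq_iff p_def flip: scaleR_add_left)
      moreover have "p a \<noteq> p b" using t(1) by (auto simp: vec_eq_iff p_def)
      ultimately have "x \<in> open_segment (p a) (p b)"
        using t(2,3) unfolding in_segment by blast
      moreover have "p a \<in> {y. \<forall>i. y $ i \<in> S}" "p b \<in> {y. \<forall>i. y $ i \<in> S}"
        using x ab(1,2) by (auto simp: p_def extreme_point_of_def)
      ultimately show False using x unfolding extreme_point_of_def by blast
    qed
    then show "x $ i extreme_point_of S"
      using x by (auto simp: extreme_point_of_def)
  qed
next
  assume x: "\<forall>i. x $ i extreme_point_of S"
  have False if ab: "\<forall>i. a $ i \<in> S" "\<forall>i. b $ i \<in> S" "x \<in> open_segment a b" for a b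
  proof -
    from ab(3) obtain t where t: "a \<noteq> b" "0 < t" "t < 1" "x = (1 - t) *\<^sub>R a + t *\<^sub>R b"
      unfolding in_segment by blast
    from t(1) obtain i where "a $ i \<noteq> b $ i" by (auto simp: vec_eq_iff)
    with t have "x $ i \<in> open_segment (a $ i) (b $ i)"
      unfolding in_segment by auto
    with x ab(1,2) show False unfolding extreme_point_of_def by blast
  qed
  with x show "x extreme_point_of {y. \<forall>i. y $ i \<in> S}"
    by (auto simp: extreme_point_of_def)
qed

lemma card_vec_components_in:
  "card {x :: 'a ^ 'n. \<forall>i. x $ i \<in> S} = card S ^ CARD('n)"
proof -
  have "{x :: 'a ^ 'n. \<forall>i. x $ i \<in> S} = vec_lambda ` (UNIV \<rightarrow>\<^sub>E S)"
  proof (intro equalityI subsetI)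
    fix x :: "'a ^ 'n" assume "x \<in> {x. \<forall>i. x $ i \<in> S}"
    then have "x = vec_lambda (($) x)" "($) x \<in> UNIV \<rightarrow>\<^sub>E S"
      by (auto simp: PiE_UNIV_domain)
    then show "x \<in> vec_lambda ` (UNIV \<rightarrow>\<^sub>E S)" by blast
  qed (auto simp: PiE_UNIV_domain)
  moreover have "inj_on (vec_lambda :: _ \<Rightarrow> 'a ^ 'n) (UNIV \<rightarrow>\<^sub>E S)"
    by (rule inj_onI) (simp add: vec_lambda_inject)
  ultimately show ?thesis by (simp add: card_image card_funcsetE)
qed

section \<open>The polar of a polygon\<close>

text \<open>
  The one-sided polar, with \<open>g \<bullet> y \<le> 1\<close> instead of \<open>\<bar>g \<bullet> y\<bar> \<le> 1\<close>; for symmetric sets the two agree.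
\<close>

definition polar :: "'a::real_inner set \<Rightarrow> 'a set" where
  "polar S = {g. \<forall>y\<in>S. g \<bullet> y \<le> 1}"

lemma polar_convex_hull: "polar (convex hull S) = polar S"
proof -
  have "convex hull S \<subseteq> {y. g \<bullet> y \<le> 1}" if "g \<in> polar S" for g
    using that by (intro hull_minimal convex_halfspace_le) (auto simp: polar_def)
  then show ?thesis by (auto simp: polar_def hull_inc)
qed

lemma in_frontier_if_polar_active:
  assumes g: "g \<in> polar K" and y: "y \<in> K" "g \<bullet> y = 1"
  shows "y \<in> frontier K"
proof -
  have "y \<notin> interior K"
  proof
    assume "y \<in> interior K"
    moreover have "K \<subseteq> {y. g \<bullet> y \<le> 1}" using g by (auto simp: polar_def)
    ultimately have "y \<in> interior {y. g \<bullet> y \<le> 1}" using interior_mono by blast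
    moreover have "(\<bullet>) g \<noteq> (\<lambda>_. 0)" using y(2) by (metis zero_neq_one)
    ultimately have "g \<bullet> y < 1"
      by (intro less_if_in_interior_halfspace bounded_linear_inner_right)
    with y(2) show False by simp
  qed
  with y(1) closure_subset show ?thesis by (auto simp: frontier_def)
qed

text \<open>
  A supporting hyperplane does not pass through the interior point \<open>0\<close>, so it can be
  rescaled to level one.
\<close>

lemma frontier_point_polar_active:
  fixes K :: "'a::euclidean_space set"
  assumes K: "convex K" "closed K" "0 \<in> interior K" and z: "z \<in> frontier K"
  obtains g where "g \<in> polar K" "g \<bullet> z = 1"
proof -
  have cl: "closure K = K" using K(2) by simp
  have "rel_interior K = interior K"
    using K(3) by (intro rel_interior_nonempty_interior) auto
  then have "z \<in> closure K" "z \<notin> rel_interior K" using z by (auto simp: frontier_def)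
  then obtain a where a: "a \<noteq> 0" "\<And>y. y \<in> closure K \<Longrightarrow> a \<bullet> z \<le> a \<bullet> y"
    using supporting_hyperplane_relative_frontier[OF K(1)] by blast
  have "0 \<in> interior {y. - a \<bullet> y \<le> - a \<bullet> z}"
    using K(3) a(2) interior_mono[of K "{y. - a \<bullet> y \<le> - a \<bullet> z}"] cl by auto
  moreover have "(\<bullet>) (- a) \<noteq> (\<lambda>_. 0)"
    using a(1) by (metis inner_eq_zero_iff neg_equal_0_iff_equal)
  ultimately have "- a \<bullet> 0 < - a \<bullet> z"
    by (intro less_if_in_interior_halfspace bounded_linear_inner_right)
  then have pos: "- (a \<bullet> z) > 0" by simp
  define g where "g = (1 / - (a \<bullet> z)) *\<^sub>R (- a)"
  show thesis
  proof
    show "g \<bullet> z = 1" using pos by (simp add: g_def)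
    show "g \<in> polar K"
      using a(2) pos unfolding cl by (auto simp: polar_def g_def field_simps)
  qed
qed

text \<open>
  Faces of polyhedra are exposed. On the hull, the exposing functional takes its maximum only at \<open>w\<close>,
  which is not the interior point \<open>0\<close>; so the maximum is positive and can be rescaled to one.
\<close>

lemma vertex_exposed_by_polar:
  fixes W :: "'a::euclidean_space set"
  assumes W: "finite W" "0 \<in> interior (convex hull W)"
    and w: "w extreme_point_of convex hull W"
  obtains g where "g \<in> polar W" "g \<bullet> w = 1" "\<And>y. y \<in> W - {w} \<Longrightarrow> g \<bullet> y < 1"
proof -
  let ?K = "convex hull W"
  have "{w} exposed_face_of ?K"
    using W(1) w by (simp add: exposed_face_of_polyhedron polyhedron_convex_hull face_of_singleton)
  then obtain a b where ab: "?K \<subseteq> {x. a \<bullet> x \<le> b}" "{w} = ?K \<inter> {x. a \<bullet> x = b}"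
    unfolding exposed_face_of_def by blast
  have "w \<noteq> 0" using W(2) extreme_point_not_in_interior[OF w] by blast
  moreover have "0 \<in> ?K" using W(2) interior_subset by blast
  ultimately have "a \<bullet> 0 \<noteq> b" using ab(2) by (metis Int_iff mem_Collect_eq singletonD)
  moreover have "a \<bullet> 0 \<le> b" using ab(1) W(2) interior_subset[of ?K] by blast
  ultimately have b: "b > 0" by simp
  define g where "g = (1 / b) *\<^sub>R a"
  show thesis
  proof
    show "g \<bullet> w = 1" using ab(2) b by (auto simp: g_def)
    have "a \<bullet> y \<le> b" if "y \<in> W" for y using ab(1) hull_subset[of W convex] that by blast
    then show "g \<in> polar W" using b by (simp add: polar_def g_def divide_le_eq_1_pos)
    have "a \<bullet> y < b" if "y \<in> W - {w}" for y
    proof -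
      have "y \<in> ?K" "y \<noteq> w" using that by (auto simp: hull_inc)
      then have "a \<bullet> y \<le> b" "a \<bullet> y \<noteq> b" using ab by blast+
      then show ?thesis by simp
    qed
    then show "g \<bullet> y < 1" if "y \<in> W - {w}" for y using that b by (simp add: g_def)
  qed
qed

lemma inner_real2: "g \<bullet> y = g $ 1 * y $ 1 + g $ 2 * y $ 2" for g y :: "real ^ 2"
  by (simp add: inner_vec_def sum_2)

text \<open>
  Distinct points on a line that misses the origin are linearly independent, so they determine the
  functional.
\<close>

lemma unit_line_functional_unique:
  fixes a b g h :: "real ^ 2"
  assumes "a \<noteq> b" "g \<bullet> a = 1" "g \<bullet> b = 1" "h \<bullet> a = 1" "h \<bullet> b = 1"
  shows "g = h"
proof -
  \<comment> \<open>the determinant of \<open>a\<close> and \<open>b\<close>; if it vanished, the two equations for \<open>g\<close> would give \<open>a = b\<close>\<close>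
  let ?D = "a $ 1 * b $ 2 - a $ 2 * b $ 1"
  have ga: "g $ 1 * a $ 1 + g $ 2 * a $ 2 = 1" and gb: "g $ 1 * b $ 1 + g $ 2 * b $ 2 = 1"
    and ha: "h $ 1 * a $ 1 + h $ 2 * a $ 2 = 1" and hb: "h $ 1 * b $ 1 + h $ 2 * b $ 2 = 1"
    using assms by (simp_all add: inner_real2)
  have "b $ 1 - a $ 1 = - (g $ 2) * ?D" "b $ 2 - a $ 2 = g $ 1 * ?D"
    using ga gb by algebra+
  then have D: "?D \<noteq> 0" using assms(1) by (auto simp: vec_eq_iff forall_2)
  have "(g $ 1 - h $ 1) * ?D = 0" "(g $ 2 - h $ 2) * ?D = 0"
    using ga gb ha hb by algebra+
  with D show ?thesis by (simp add: vec_eq_iff forall_2)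
qed

lemma orthogonal_direction_exists:
  fixes w :: "real ^ 2"
  obtains d where "d \<noteq> 0" "d \<bullet> w = 0"
proof (cases "w = 0")
  case True
  then show thesis by (intro that[of "axis 1 1"]) (auto simp: axis_eq_0_iff)
next
  case False
  show thesis
  proof (rule that)
    show "vector [- (w $ 2), w $ 1] \<noteq> (0 :: real ^ 2)"
      using False by (auto simp: vec_eq_iff forall_2)
    show "vector [- (w $ 2), w $ 1] \<bullet> w = 0" by (simp add: inner_real2)
  qed
qed

text \<open>
  If at most one constraint is tight at \<open>g\<close>, then \<open>g\<close> can be moved in both directions orthogonally to
  the tight vertex: the tight constraint stays tight and the finitely many strict ones stay strict for
  small moves.
\<close>

lemma extreme_polar_two_active:
  fixes W :: "(real ^ 2) set"
  assumes W: "finite W" and g: "g extreme_point_of polar W"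
  obtains a b where "a \<in> W" "b \<in> W" "a \<noteq> b" "g \<bullet> a = 1" "g \<bullet> b = 1"
proof (rule ccontr)
  assume "\<not> thesis"
  then have "\<exists>w. \<forall>a\<in>W. g \<bullet> a = 1 \<longrightarrow> a = w" using that by metis
  then obtain w where w: "\<And>a. a \<in> W \<Longrightarrow> g \<bullet> a = 1 \<Longrightarrow> a = w" by blast
  obtain d where d: "d \<noteq> 0" "d \<bullet> w = 0" by (rule orthogonal_direction_exists)
  have g_le: "g \<bullet> a \<le> 1" if "a \<in> W" for a
    using g that by (auto simp: extreme_point_of_def polar_def)
  have small: "\<forall>\<^sub>F t in at_right 0. (g + t *\<^sub>R d) \<bullet> a \<le> 1 \<and> (g - t *\<^sub>R d) \<bullet> a \<le> 1"
    if a: "a \<in> W" for a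
  proof (cases "g \<bullet> a = 1")
    case True
    with w[OF a] d(2) show ?thesis by (simp add: inner_add_left inner_diff_left)
  next
    case False
    with g_le[OF a] have less: "g \<bullet> a < 1" by simp
    have "((\<lambda>t. (g + t *\<^sub>R d) \<bullet> a) \<longlongrightarrow> (g + 0 *\<^sub>R d) \<bullet> a) (at_right 0)"
      "((\<lambda>t. (g - t *\<^sub>R d) \<bullet> a) \<longlongrightarrow> (g - 0 *\<^sub>R d) \<bullet> a) (at_right 0)"
      by (intro tendsto_intros)+
    then have "\<forall>\<^sub>F t in at_right 0. (g + t *\<^sub>R d) \<bullet> a < 1"
      "\<forall>\<^sub>F t in at_right 0. (g - t *\<^sub>R d) \<bullet> a < 1"
      using less by (auto intro: order_tendstoD(2))
    then show ?thesis by eventually_elim simp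
  qed
  have "\<forall>\<^sub>F t in at_right 0. \<forall>a\<in>W. (g + t *\<^sub>R d) \<bullet> a \<le> 1 \<and> (g - t *\<^sub>R d) \<bullet> a \<le> 1"
    using W small by (simp add: eventually_ball_finite)
  moreover have "\<forall>\<^sub>F t in at_right (0::real). 0 < t"
    by (simp add: eventually_at_right_less)
  ultimately have "\<forall>\<^sub>F t in at_right 0. 0 < t \<and>
      (\<forall>a\<in>W. (g + t *\<^sub>R d) \<bullet> a \<le> 1 \<and> (g - t *\<^sub>R d) \<bullet> a \<le> 1)"
    by eventually_elim simp
  from eventually_happens'[OF trivial_limit_at_right_real this]
  obtain t where t: "t > 0" "g + t *\<^sub>R d \<in> polar W" "g - t *\<^sub>R d \<in> polar W"
    unfolding polar_def by blast
  have "g = midpoint (g + t *\<^sub>R d) (g - t *\<^sub>R d)"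
    by (simp add: midpoint_def scaleR_2[symmetric])
  moreover have "g + t *\<^sub>R d \<noteq> g - t *\<^sub>R d"
  proof
    assume "g + t *\<^sub>R d = g - t *\<^sub>R d"
    moreover have "(2 * t) *\<^sub>R d = (g + t *\<^sub>R d) - (g - t *\<^sub>R d)"
      by (simp flip: scaleR_add_left)
    ultimately have "(2 * t) *\<^sub>R d = 0" by simp
    with t(1) d(1) show False by simp
  qed
  ultimately have "g \<in> open_segment (g + t *\<^sub>R d) (g - t *\<^sub>R d)"
    by (metis midpoint_in_open_segment)
  with t(2,3) g show False unfolding extreme_point_of_def by blast
qed

text \<open>
  Of three distinct points on a line, one lies between the other two.
\<close>

lemma extreme_points_on_line:
  fixes K :: "(real ^ 2) set"
  assumes abc: "a extreme_point_of K" "b extreme_point_of K" "c extreme_point_of K"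
    and g: "g \<bullet> a = 1" "g \<bullet> b = 1" "g \<bullet> c = 1"
  shows "a = b \<or> a = c \<or> b = c"
proof (rule ccontr)
  assume "\<not> ?thesis"
  then have ne: "a \<noteq> b" "a \<noteq> c" "b \<noteq> c" by auto
  have "g \<noteq> 0" using g(1) by auto
  have "aff_dim {a, b, c} \<le> aff_dim {y. g \<bullet> y = 1}"
    using g by (intro aff_dim_subset) auto
  then have "collinear {a, b, c}"
    using \<open>g \<noteq> 0\<close> by (simp add: collinear_aff_dim)
  then have "a \<in> closed_segment b c \<or> b \<in> closed_segment c a \<or> c \<in> closed_segment a b"
    by (simp add: collinear_between_cases between_mem_segment)
  with ne have "a \<in> open_segment b c \<or> b \<in> open_segment c a \<or> c \<in> open_segment a b"
    by (auto simp: open_segment_def)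
  with abc show False unfolding extreme_point_of_def by blast
qed


text \<open>
  The maximum principle for linear functionals: a bound attained inside a segment is attained at both ends.
\<close>

lemma inner_eq_1_at_segment_ends:
  assumes g: "g \<bullet> a \<le> 1" "g \<bullet> b \<le> 1" and p: "p \<in> open_segment a b" "g \<bullet> p = 1"
  shows "g \<bullet> a = 1 \<and> g \<bullet> b = 1"
proof -
  from p(1) obtain t where t: "0 < t" "t < 1" "p = (1 - t) *\<^sub>R a + t *\<^sub>R b"
    unfolding in_segment by blast
  have "g \<bullet> p = (1 - t) * (g \<bullet> a) + t * (g \<bullet> b)" by (simp add: t(3) inner_add_right)
  then have "(1 - t) * (1 - g \<bullet> a) + t * (1 - g \<bullet> b) = 0"
    using p(2) by (simp add: algebra_simps)
  moreover have "(1 - t) * (1 - g \<bullet> a) \<ge> 0" "t * (1 - g \<bullet> b) \<ge> 0" using t g by simp_all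
  ultimately have "(1 - t) * (1 - g \<bullet> a) = 0" "t * (1 - g \<bullet> b) = 0" by linarith+
  with t show ?thesis by simp
qed

text \<open>
  Two tight constraints determine a point of the plane, and they remain tight along any segment of the
  polar around that point; so two tight constraints are also sufficient for extremality.
\<close>

lemma extreme_point_of_polar_iff:
  fixes W :: "(real ^ 2) set"
  assumes "finite W"
  shows "g extreme_point_of polar W \<longleftrightarrow>
    g \<in> polar W \<and> (\<exists>a\<in>W. \<exists>b\<in>W. a \<noteq> b \<and> g \<bullet> a = 1 \<and> g \<bullet> b = 1)"
proof
  assume g: "g extreme_point_of polar W"
  then show "g \<in> polar W \<and> (\<exists>a\<in>W. \<exists>b\<in>W. a \<noteq> b \<and> g \<bullet> a = 1 \<and> g \<bullet> b = 1)"
    using extreme_polar_two_active[OF assms g] unfolding extreme_point_of_def by metis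
next
  assume "g \<in> polar W \<and> (\<exists>a\<in>W. \<exists>b\<in>W. a \<noteq> b \<and> g \<bullet> a = 1 \<and> g \<bullet> b = 1)"
  then obtain a b where g: "g \<in> polar W" and ab: "a \<in> W" "b \<in> W" "a \<noteq> b" "g \<bullet> a = 1" "g \<bullet> b = 1"
    by blast
  have False if pq: "p \<in> polar W" "q \<in> polar W" "g \<in> open_segment p q" for p q
  proof -
    have active: "p \<bullet> w = 1 \<and> q \<bullet> w = 1" if w: "w \<in> W" "g \<bullet> w = 1" for w
    proof -
      have "w \<bullet> p \<le> 1" "w \<bullet> q \<le> 1" "w \<bullet> g = 1"
        using pq(1,2) w by (auto simp: polar_def inner_commute[of w])
      from inner_eq_1_at_segment_ends[OF this(1,2) pq(3) this(3)] show ?thesis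
        by (simp add: inner_commute[of _ w])
    qed
    then have "p = q"
      using unit_line_functional_unique[of a b p q] ab by blast
    with pq(3) show False by simp
  qed
  with g show "g extreme_point_of polar W" unfolding extreme_point_of_def by blast
qed

text \<open>
  The extreme points of the polar correspond bijectively to the edges of the polygon: \<open>edge k g\<close> says
  that \<open>g\<close> supports the polygon along its \<open>k\<close>-th edge. That the polygonal curve is the whole frontier of
  the hull enters twice: edges lie in the frontier, hence have supporting lines, and any two vertices on
  a common supporting line have their midpoint on some edge, which then lies on the same line.
\<close>

lemma card_extreme_points_polar_polygon:
  assumes poly: "convex_polygon m v" and zero: "0 \<in> interior (convex hull (v ` {..<m}))"
  shows "card {g. g extreme_point_of polar (v ` {..<m})} = m"
proof -
  let ?W = "v ` {..<m}"
  let ?K = "convex hull ?W"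
  define nxt where "nxt k = Suc k mod m" for k
  from poly have m: "3 \<le> m" and inj: "inj_on v {..<m}"
    and ext: "\<And>k. k < m \<Longrightarrow> v k extreme_point_of ?K"
    and curve: "frontier ?K = (\<Union>k<m. closed_segment (v k) (v (nxt k)))"
    by (auto simp: convex_polygon_def polygonal_curve_def nxt_def)
  have nxt: "nxt k < m" for k using m by (simp add: nxt_def)
  have v_eq: "v k = v l \<longleftrightarrow> k = l" if "k < m" "l < m" for k l
    using inj that by (auto dest: inj_onD)
  have nxt_ne: "nxt k \<noteq> k" if "k < m" for k
    using m that by (auto simp: nxt_def mod_Suc)
  have K: "convex ?K" "closed ?K" by (simp_all add: compact_imp_closed finite_imp_compact_convex_hull)
  define edge where "edge k g \<longleftrightarrow> g \<in> polar ?W \<and> g \<bullet> v k = 1 \<and> g \<bullet> v (nxt k) = 1" for k g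
  have edge_ex: "\<exists>g. edge k g" if k: "k < m" for k
  proof -
    have mid: "midpoint (v k) (v (nxt k)) \<in> open_segment (v k) (v (nxt k))"
      using v_eq[OF k nxt] nxt_ne[OF k] by auto
    then have "midpoint (v k) (v (nxt k)) \<in> frontier ?K"
      unfolding curve using k by (intro UN_I[of k]) simp_all
    then obtain g where g: "g \<in> polar ?W" "g \<bullet> midpoint (v k) (v (nxt k)) = 1"
      using frontier_point_polar_active[OF K zero] polar_convex_hull by metis
    then have "g \<bullet> v k \<le> 1" "g \<bullet> v (nxt k) \<le> 1" using k nxt by (auto simp: polar_def)
    from inner_eq_1_at_segment_ends[OF this mid g(2)] g(1) show ?thesis by (auto simp: edge_def)
  qed
  have edge_unique: "g = h" if "edge k g" "edge k h" "k < m" for g h k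
    using that v_eq[OF \<open>k < m\<close> nxt] nxt_ne[of k]
      unit_line_functional_unique[of "v k" "v (nxt k)" g h]
    by (auto simp: edge_def)
  define e where "e k = (THE g. edge k g)" for k
  have e: "edge k (e k)" if "k < m" for k
    unfolding e_def using edge_ex[OF that] edge_unique[OF _ _ that] by (metis theI')
  have "{g. g extreme_point_of polar ?W} = e ` {..<m}"
  proof (intro equalityI subsetI)
    fix g assume "g \<in> {g. g extreme_point_of polar ?W}"
    then obtain i j where g: "g \<in> polar ?W" and ij: "i < m" "j < m" "v i \<noteq> v j"
      "g \<bullet> v i = 1" "g \<bullet> v j = 1"
      by (auto simp: extreme_point_of_polar_iff)
    \<comment> \<open>\<open>p\<close> lies on some edge, but is not a vertex, so \<open>g\<close> is tight at both ends of that edge\<close>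
    define p where "p = midpoint (v i) (v j)"
    have p: "p \<in> open_segment (v i) (v j)" "g \<bullet> p = 1"
    proof -
      show "p \<in> open_segment (v i) (v j)" using ij(3) by (simp add: p_def)
      show "g \<bullet> p = 1" using ij(4,5) by (simp add: p_def midpoint_def inner_add_right)
    qed
    have vK: "v k \<in> ?K" if "k < m" for k using that by (simp add: hull_inc)
    have "p \<in> ?K"
      using p(1) vK ij(1,2) K(1) by (meson closed_segment_subset convex_contains_open_segment subsetD)
    then have "p \<in> frontier ?K"
      using in_frontier_if_polar_active[of g ?K p] p(2) g by (simp add: polar_convex_hull)
    then obtain k where k: "k < m" "p \<in> closed_segment (v k) (v (nxt k))"
      unfolding curve by blast
    have "p \<noteq> v l" if "l < m" for l
      using ext[OF that] vK ij(1,2) p(1) unfolding extreme_point_of_def by blast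
    with k nxt have "p \<in> open_segment (v k) (v (nxt k))" by (simp add: open_segment_def)
    then have "edge k g"
      using inner_eq_1_at_segment_ends[of g "v k" "v (nxt k)" p] p(2) g k(1) nxt
      by (auto simp: edge_def polar_def)
    with edge_unique[OF _ e] k(1) show "g \<in> e ` {..<m}" by blast
  next
    fix g assume "g \<in> e ` {..<m}"
    then obtain k where "k < m" "edge k g" using e by blast
    moreover from this have "v k \<noteq> v (nxt k)" using v_eq nxt nxt_ne by metis
    ultimately show "g \<in> {g. g extreme_point_of polar ?W}"
      using nxt by (auto simp: extreme_point_of_polar_iff edge_def)
  qed
  moreover have "inj_on e {..<m}"
  proof (rule inj_onI, rule ccontr)
    fix k l assume kl: "k \<in> {..<m}" "l \<in> {..<m}" "e k = e l" "k \<noteq> l"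
    then have k: "k < m" and l: "l < m" by auto
    \<comment> \<open>the ends of both edges lie on one line, which carries only two vertices; two different edges
      would have to be each other's successor, impossible for at least three vertices\<close>
    have act: "e k \<bullet> v k = 1" "e k \<bullet> v (nxt k) = 1" "e k \<bullet> v l = 1" "e k \<bullet> v (nxt l) = 1"
      using e[OF k] e[OF l] kl(3) by (auto simp: edge_def)
    have "l = nxt k"
      using extreme_points_on_line[OF ext[OF k] ext[OF nxt] ext[OF l] act(1-3)]
        v_eq k l nxt nxt_ne kl(4) by metis
    moreover have "k = nxt l"
      using extreme_points_on_line[OF ext[OF k] ext[OF l] ext[OF nxt] act(1,3,4)]
        v_eq k l nxt nxt_ne kl(4) by metis
    ultimately show False
      using m k l by (auto simp: nxt_def mod_Suc split: if_splits)
  qed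
  ultimately show ?thesis by (simp add: card_image)
qed

section \<open>Operators into the maximum norm space as tuples of functionals\<close>

lemma norm_linf_le_iff: "norm x \<le> c \<longleftrightarrow> (\<forall>i. \<bar>Rep_linf x $ i\<bar> \<le> c)"
  by (simp add: norm_linf.rep_eq)

lemma bounded_linear_Rep_linf_nth: "bounded_linear (\<lambda>x. Rep_linf x $ i)"
proof (rule bounded_linear_intro[where K = 1])
  show "norm (Rep_linf x $ i) \<le> norm x * 1" for x :: "'a linf"
    using norm_linf_le_iff[of x "norm x"] by simp
qed (simp_all add: plus_linf.rep_eq scaleR_linf.rep_eq)

text \<open>
  Through \<open>\<phi>\<close>, a functional on the domain becomes an inner product with a vector, so that an operator
  becomes a matrix whose rows are the coordinate functionals.
\<close>

definition operator_of_rows ::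
    "('x::real_normed_vector \<Rightarrow> 'e::euclidean_space) \<Rightarrow> 'e ^ 'n::finite \<Rightarrow> 'x \<Rightarrow>\<^sub>L 'n linf" where
  "operator_of_rows \<phi> G = Blinfun (\<lambda>x. Abs_linf (\<chi> i. G $ i \<bullet> \<phi> x))"

lemma operator_of_rows_nth:
  fixes \<phi> :: "'x::real_normed_vector \<Rightarrow> 'e::euclidean_space"
  assumes "bounded_linear \<phi>"
  shows "Rep_linf (blinfun_apply (operator_of_rows \<phi> G) x) $ i = G $ i \<bullet> \<phi> x"
proof -
  interpret bounded_linear \<phi> by (rule assms)
  from nonneg_bounded obtain B where B: "B \<ge> 0" "\<And>x. norm (\<phi> x) \<le> norm x * B" by blast
  let ?f = "\<lambda>x. Abs_linf (\<chi> i. G $ i \<bullet> \<phi> x)"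
  have "bounded_linear ?f"
  proof (rule bounded_linear_intro)
    show "?f (x + y) = ?f x + ?f y" for x y
      by (simp add: plus_linf.abs_eq eq_onp_same_args add inner_add_right vec_eq_iff
          Abs_linf_inject)
    show "?f (r *\<^sub>R x) = r *\<^sub>R ?f x" for r x
      by (simp add: scaleR_linf.abs_eq eq_onp_same_args scaleR vec_eq_iff Abs_linf_inject)
    show "norm (?f x) \<le> norm x * (B * (\<Sum>i\<in>UNIV. norm (G $ i)))" for x
      unfolding norm_linf_le_iff
    proof
      fix i
      have "\<bar>G $ i \<bullet> \<phi> x\<bar> \<le> norm (G $ i) * norm (\<phi> x)" by (rule Cauchy_Schwarz_ineq2)
      also have "\<dots> \<le> (\<Sum>i\<in>UNIV. norm (G $ i)) * (norm x * B)"
        using B by (intro mult_mono member_le_sum sum_nonneg) auto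
      finally show "\<bar>Rep_linf (?f x) $ i\<bar> \<le> norm x * (B * (\<Sum>i\<in>UNIV. norm (G $ i)))"
        by (simp add: Abs_linf_inverse algebra_simps)
    qed
  qed
  then show ?thesis
    by (simp add: operator_of_rows_def bounded_linear_Blinfun_apply Abs_linf_inverse)
qed

lemma linf_eq_iff: "x = y \<longleftrightarrow> (\<forall>i. Rep_linf x $ i = Rep_linf y $ i)"
  by (metis Rep_linf_inject vec_eq_iff)

lemma linear_operator_of_rows:
  fixes \<phi> :: "'x::real_normed_vector \<Rightarrow> 'e::euclidean_space"
  assumes "bounded_linear \<phi>"
  shows "linear (operator_of_rows \<phi>)"
  by (rule linearI)
    (auto intro!: blinfun_eqI simp: linf_eq_iff operator_of_rows_nth[OF assms] blinfun.add_left
      blinfun.scaleR_left plus_linf.rep_eq scaleR_linf.rep_eq inner_add_left)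

text \<open>
  For arbitrary real vector spaces, because the type of the domain of \<open>\<phi>\<close> carries no Euclidean
  structure.
\<close>

lemma linear_inv_of_bij:
  assumes f: "linear f" "bij f"
  shows "linear (inv f)"
proof -
  have "f (inv f y) = y" for y using f(2) by (simp add: surj_f_inv_f bij_is_surj)
  then show ?thesis
    by (intro linearI injD[OF bij_is_inj[OF f(2)]]) (simp_all add: linear_add linear_scale f(1))
qed

text \<open>
  Surjectivity is the Riesz representation of the coordinate functionals, pulled back along \<open>inv \<phi>\<close>.
\<close>

lemma bij_operator_of_rows:
  fixes \<phi> :: "'x::real_normed_vector \<Rightarrow> 'e::euclidean_space"
  assumes \<phi>: "bounded_linear \<phi>" "bij \<phi>"
  shows "bij (operator_of_rows \<phi> :: 'e ^ 'n \<Rightarrow> 'x \<Rightarrow>\<^sub>L 'n::finite linf)"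
proof (rule bijI)
  show "inj (operator_of_rows \<phi> :: 'e ^ 'n \<Rightarrow> 'x \<Rightarrow>\<^sub>L 'n linf)"
  proof (rule injI)
    fix G H :: "'e ^ 'n"
    assume "operator_of_rows \<phi> G = (operator_of_rows \<phi> H :: 'x \<Rightarrow>\<^sub>L 'n linf)"
    then have "G $ i \<bullet> \<phi> x = H $ i \<bullet> \<phi> x" for i x
      by (metis operator_of_rows_nth[OF \<phi>(1)])
    then have "G $ i \<bullet> y = H $ i \<bullet> y" for i y
      using bij_is_surj[OF \<phi>(2)] by (metis surjD)
    then have "G $ i = H $ i" for i using vector_eq_rdot by blast
    then show "G = H" by (simp add: vec_eq_iff)
  qed
  have "T \<in> range (operator_of_rows \<phi>)" for T :: "'x \<Rightarrow>\<^sub>L 'n linf"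
  proof -
    define h where "h i y = Rep_linf (blinfun_apply T (inv \<phi> y)) $ i" for i y
    define G where "G = (\<chi> i. \<Sum>b\<in>Basis. h i b *\<^sub>R b)"
    have "linear (inv \<phi>)"
      using \<phi> by (simp add: linear_inv_of_bij bounded_linear.linear)
    then have "linear (\<lambda>y. blinfun_apply T (inv \<phi> y))"
      using linear_compose[of "inv \<phi>" "blinfun_apply T"]
      by (simp add: o_def bounded_linear.linear blinfun.bounded_linear_right)
    then have lin: "linear (h i)" for i
      unfolding h_def[abs_def]
      using linear_compose[OF _ bounded_linear.linear[OF bounded_linear_Rep_linf_nth[of i]]]
      by (simp add: o_def)
    have "G $ i \<bullet> y = h i y" for i y
    proof -
      interpret h: linear "h i" by (rule lin)
      have "h i y = h i (\<Sum>b\<in>Basis. (y \<bullet> b) *\<^sub>R b)" by (simp add: euclidean_representation)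
      also have "\<dots> = G $ i \<bullet> y"
        by (simp add: h.sum h.scaleR G_def inner_sum_left inner_commute[of y] mult.commute)
      finally show ?thesis by simp
    qed
    then have "Rep_linf (blinfun_apply T x) $ i = G $ i \<bullet> \<phi> x" for i x
      by (simp add: h_def inv_f_f[OF bij_is_inj[OF \<phi>(2)]])
    then have "T = operator_of_rows \<phi> G"
      by (intro blinfun_eqI) (simp add: linf_eq_iff operator_of_rows_nth[OF \<phi>(1)])
    then show ?thesis by blast
  qed
  then show "surj (operator_of_rows \<phi> :: 'e ^ 'n \<Rightarrow> 'x \<Rightarrow>\<^sub>L 'n linf)" by blast
qed

lemma norm_blinfun_le_1_iff: "norm T \<le> 1 \<longleftrightarrow> (\<forall>x\<in>cball 0 1. norm (blinfun_apply T x) \<le> 1)"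
proof
  assume T: "norm T \<le> 1"
  have "norm (blinfun_apply T x) \<le> 1" if x: "norm x \<le> 1" for x
  proof -
    have "norm (blinfun_apply T x) \<le> norm T * norm x" by (rule norm_blinfun)
    also have "\<dots> \<le> 1 * 1" by (intro mult_mono T x) auto
    finally show ?thesis by simp
  qed
  then show "\<forall>x\<in>cball 0 1. norm (blinfun_apply T x) \<le> 1" by simp
next
  assume T: "\<forall>x\<in>cball 0 1. norm (blinfun_apply T x) \<le> 1"
  show "norm T \<le> 1"
  proof (rule norm_blinfun_bound)
    fix x
    show "norm (blinfun_apply T x) \<le> 1 * norm x"
    proof (cases "x = 0")
      case False
      with T have "norm (blinfun_apply T ((1 / norm x) *\<^sub>R x)) \<le> 1" by simp
      with False show ?thesis by (simp add: blinfun.scaleR_right field_simps)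
    qed simp
  qed simp
qed

text \<open>
  Absolute values can be dropped from the norm condition because the unit ball is symmetric.
\<close>

lemma operator_of_rows_mem_cball_iff:
  fixes \<phi> :: "'x::real_normed_vector \<Rightarrow> 'e::euclidean_space" and G :: "'e ^ 'n::finite"
  assumes \<phi>: "bounded_linear \<phi>" and ball: "\<phi> ` cball 0 1 = convex hull W"
  shows "(operator_of_rows \<phi> G :: 'x \<Rightarrow>\<^sub>L 'n linf) \<in> cball 0 1 \<longleftrightarrow> (\<forall>i. G $ i \<in> polar W)"
proof -
  interpret bounded_linear \<phi> by (rule \<phi>)
  have "(operator_of_rows \<phi> G :: 'x \<Rightarrow>\<^sub>L 'n linf) \<in> cball 0 1 \<longleftrightarrow>
      (\<forall>i. \<forall>x\<in>cball 0 1. \<bar>G $ i \<bullet> \<phi> x\<bar> \<le> 1)"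
    by (auto simp: norm_blinfun_le_1_iff norm_linf_le_iff operator_of_rows_nth[OF \<phi>])
  also have "\<dots> \<longleftrightarrow> (\<forall>i. \<forall>x\<in>cball 0 1. G $ i \<bullet> \<phi> x \<le> 1)"
  proof (intro iff_allI iffI ballI)
    fix i and x :: 'x
    assume le: "\<forall>x\<in>cball 0 1. G $ i \<bullet> \<phi> x \<le> 1" and x: "x \<in> cball 0 1"
    have "G $ i \<bullet> \<phi> x \<le> 1" "G $ i \<bullet> \<phi> (- x) \<le> 1" using le x by simp_all
    then show "\<bar>G $ i \<bullet> \<phi> x\<bar> \<le> 1" by (simp add: neg)
  qed fastforce
  also have "\<dots> \<longleftrightarrow> (\<forall>i. G $ i \<in> polar (\<phi> ` cball 0 1))" by (simp add: polar_def)
  finally show ?thesis by (simp add: ball polar_convex_hull)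
qed

section \<open>Recovering a unit ball from its sphere\<close>

text \<open>
  Each point of the unit ball lies on a segment between two opposite unit vectors, and a compact
  convex set is the convex hull of its frontier, so either of the two sets contains the other. Boundedness
  of \<open>\<phi>\<close> follows because the image of the sphere is bounded, and \<open>0\<close> is interior because \<open>inv \<phi>\<close>, being
  linear on a Euclidean space, is continuous.
\<close>

lemma image_cball_eq_if_image_sphere_eq_frontier:
  fixes \<phi> :: "'x::real_normed_vector \<Rightarrow> 'e::euclidean_space"
  assumes \<phi>: "linear \<phi>" "bij \<phi>" and K: "convex K" "compact K"
    and sphere: "\<phi> ` sphere 0 1 = frontier K"
  shows "bounded_linear \<phi>" "\<phi> ` cball 0 1 = K" "0 \<in> interior K"
proof -
  interpret linear \<phi> by (rule \<phi>(1))
  have inv: "\<phi> (inv \<phi> y) = y" for y using \<phi>(2) by (simp add: surj_f_inv_f bij_is_surj)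
  have lin_inv: "linear (inv \<phi>)" by (rule linear_inv_of_bij[OF \<phi>])
  have frontier_sub: "frontier K \<subseteq> K" using K(2) by (simp add: compact_imp_closed frontier_subset_closed)
  have "bounded (frontier K)" using K(2) frontier_sub by (meson bounded_subset compact_imp_bounded)
  then obtain B where B: "\<And>y. y \<in> frontier K \<Longrightarrow> norm y \<le> B" unfolding bounded_iff by blast
  show "bounded_linear \<phi>"
  proof (rule bounded_linear_intro[where K = B])
    fix x
    show "norm (\<phi> x) \<le> norm x * B"
    proof (cases "x = 0")
      case False
      then have "\<phi> ((1 / norm x) *\<^sub>R x) \<in> frontier K"
        unfolding sphere[symmetric] by (intro imageI) simp
      from B[OF this] False show ?thesis by (simp add: scale field_simps)
    qed (simp add: zero)
  qed (simp_all add: add scale)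
  have unit: "\<exists>u. norm u = 1 \<and> x = norm x *\<^sub>R u" for x :: 'x
  proof (cases "x = 0")
    case True
    obtain b :: 'e where "b \<in> Basis" using nonempty_Basis by blast
    then have "inv \<phi> b \<noteq> 0" using inv[of b] by (metis nonzero_Basis zero)
    with True show ?thesis by (intro exI[of _ "(1 / norm (inv \<phi> b)) *\<^sub>R inv \<phi> b"]) simp
  next
    case False
    then show ?thesis by (intro exI[of _ "(1 / norm x) *\<^sub>R x"]) simp
  qed
  show ball: "\<phi> ` cball 0 1 = K"
  proof
    show "\<phi> ` cball 0 1 \<subseteq> K"
    proof
      fix y assume "y \<in> \<phi> ` cball 0 1"
      then obtain x where x: "norm x \<le> 1" "y = \<phi> x" by auto
      obtain u where u: "norm u = 1" "x = norm x *\<^sub>R u" using unit by blast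
      have "\<phi> u \<in> K" "\<phi> (- u) \<in> K" using u(1) sphere frontier_sub by auto
      then have "((1 + norm x) / 2) *\<^sub>R \<phi> u + ((1 - norm x) / 2) *\<^sub>R \<phi> (- u) \<in> K"
        using x(1) by (intro convexD[OF K(1)]) (auto simp: field_simps)
      also have "((1 + norm x) / 2) *\<^sub>R \<phi> u + ((1 - norm x) / 2) *\<^sub>R \<phi> (- u) = norm x *\<^sub>R \<phi> u"
        by (simp add: neg flip: scaleR_diff_left) (simp add: field_simps)
      also have "\<dots> = y" using x(2) u(2) scale by metis
      finally show "y \<in> K" .
    qed
    have "K = convex hull (frontier K)" by (rule Krein_Milman_frontier[OF K])
    also have "\<dots> \<subseteq> \<phi> ` cball 0 1"
      unfolding sphere[symmetric]
      by (intro hull_minimal image_mono convex_linear_image \<phi>(1)) auto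
    finally show "K \<subseteq> \<phi> ` cball 0 1" .
  qed
  show "0 \<in> interior K"
  proof (rule interiorI)
    have "continuous_on UNIV (inv \<phi>)"
      using lin_inv by (simp add: linear_continuous_on linear_conv_bounded_linear)
    then show "open (inv \<phi> -` ball 0 1)" by (simp add: open_vimage)
    show "0 \<in> inv \<phi> -` ball 0 1" using linear_0[OF lin_inv] by simp
    show "inv \<phi> -` ball 0 1 \<subseteq> K"
    proof
      fix y assume "y \<in> inv \<phi> -` ball 0 1"
      then have "inv \<phi> y \<in> cball 0 1" by auto
      then show "y \<in> K" using ball inv by (metis imageI)
    qed
  qed
qed

section \<open>Counting the facets and extreme points of the operator ball\<close>

theorem theorem2p21:
  fixes \<phi> :: "'x::banach \<Rightarrow> real ^ 2" and r :: nat
  assumes "polyhedral_space TYPE('x)" and "dim (UNIV :: 'x set) = 2"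
    and "linear \<phi>" and "bij \<phi>"
    and "r \<ge> 2"
    and "regular_polygon (2 * r) (\<phi> ` sphere 0 1)"
  shows "card {F. is_facet_of F (cball (0 :: 'x \<Rightarrow>\<^sub>L 'n::finite linf) 1)} = 2 * r * CARD('n)
    \<and> card {T. T extreme_point_of cball (0 :: 'x \<Rightarrow>\<^sub>L 'n linf) 1} = (2 * r) ^ CARD('n)"
proof -
  obtain v where v: "convex_polygon (2 * r) v" "\<phi> ` sphere 0 1 = polygonal_curve (2 * r) v"
    using assms(6) unfolding regular_polygon_def by blast
  define W where "W = v ` {..<2 * r}"
  have fin: "finite W" by (simp add: W_def)
  have card_W: "card W = 2 * r" using v(1) by (simp add: W_def convex_polygon_def card_image)
  have ext: "w extreme_point_of convex hull W" if "w \<in> W" for w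
    using v(1) that by (auto simp: W_def convex_polygon_def)
  have "\<phi> ` sphere 0 1 = frontier (convex hull W)"
    using v by (simp add: W_def convex_polygon_def)
  note \<phi> = image_cball_eq_if_image_sphere_eq_frontier[OF assms(3,4) convex_convex_hull
      finite_imp_compact_convex_hull[OF fin] this]
  let ?op = "operator_of_rows \<phi> :: real ^ 2 ^ 'n \<Rightarrow> 'x \<Rightarrow>\<^sub>L 'n linf"
  let ?B = "cball (0 :: 'x \<Rightarrow>\<^sub>L 'n linf) 1"
  have bij: "bij ?op" by (rule bij_operator_of_rows[OF \<phi>(1) assms(4)])
  have mem_B: "?op G \<in> ?B \<longleftrightarrow> (\<forall>i. G $ i \<in> polar W)" for G
    by (rule operator_of_rows_mem_cball_iff[OF \<phi>(1,2)])

  \<comment> \<open>\<open>f (i, w)\<close> is the constraint functional: the \<open>i\<close>-th coordinate at the point over the vertex \<open>w\<close>\<close>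
  define f where "f p T = Rep_linf (blinfun_apply T (inv \<phi> (snd p))) $ fst p"
    for p and T :: "'x \<Rightarrow>\<^sub>L 'n linf"
  have f_op: "f p (?op G) = G $ fst p \<bullet> snd p" for p G
    using assms(4) by (simp add: f_def operator_of_rows_nth[OF \<phi>(1)] surj_f_inv_f bij_is_surj)
  have B_eq: "?B = {T. \<forall>p\<in>UNIV \<times> W. f p T \<le> 1}"
  proof (intro set_eqI)
    fix T
    obtain G where "T = ?op G" using bij by (metis bij_pointE)
    then show "T \<in> ?B \<longleftrightarrow> T \<in> {T. \<forall>p\<in>UNIV \<times> W. f p T \<le> 1}"
      using mem_B by (auto simp: f_op polar_def)
  qed
  have "card {F. is_facet_of F ?B} = card ((UNIV :: 'n set) \<times> W)"
    unfolding B_eq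
  proof (rule card_facets_irredundant_constraints)
    show "finite ((UNIV :: 'n set) \<times> W)" using fin by simp
    show "(UNIV :: 'n set) \<times> W \<noteq> {}" using card_W assms(5) by auto
    show "bounded_linear (f p)" for p
      unfolding f_def[abs_def]
      by (rule bounded_linear_compose[OF bounded_linear_Rep_linf_nth blinfun.bounded_linear_left])
    fix p assume "p \<in> (UNIV :: 'n set) \<times> W"
    then obtain i w where p: "p = (i, w)" "w \<in> W" by blast
    \<comment> \<open>the operator with the exposing functional in row \<open>i\<close> has the value 0 under all constraints of other rows\<close>
    obtain g where g: "g \<in> polar W" "g \<bullet> w = 1" "\<And>y. y \<in> W - {w} \<Longrightarrow> g \<bullet> y < 1"
      using vertex_exposed_by_polar[OF fin \<phi>(3) ext[OF p(2)]] by blast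
    have "f p (?op (axis i g)) = 1" using g(2) by (simp add: f_op p(1))
    moreover have "f q (?op (axis i g)) < 1" if "q \<in> UNIV \<times> W - {p}" for q
    proof (cases "fst q = i")
      case True
      with that have "snd q \<in> W - {w}" by (auto simp: p(1))
      with g(3) True show ?thesis by (simp add: f_op)
    qed (simp add: f_op axis_def)
    ultimately show "\<exists>T. f p T = 1 \<and> (\<forall>q\<in>UNIV \<times> W - {p}. f q T < 1)" by blast
  qed
  then have facets: "card {F. is_facet_of F ?B} = 2 * r * CARD('n)"
    by (simp add: card_cartesian_product card_W)

  have B_image: "?B = ?op ` {G. \<forall>i. G $ i \<in> polar W}"
    using bij mem_B by (auto simp: image_iff) (metis bij_pointE mem_B mem_cball_0)
  have op_extreme: "?op G extreme_point_of ?B \<longleftrightarrow> (\<forall>i. G $ i extreme_point_of polar W)" for G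
    unfolding B_image extreme_point_of_vec_iff[symmetric]
    using face_of_linear_image[OF linear_operator_of_rows[OF \<phi>(1)] bij_is_inj[OF bij], of "{G}"]
    by (simp add: face_of_singleton)
  have "{T. T extreme_point_of ?B} = ?op ` {G. \<forall>i. G $ i \<in> {g. g extreme_point_of polar W}}"
    using op_extreme by (auto simp: image_iff) (metis bij bij_pointE)
  then have "card {T. T extreme_point_of ?B} =
      card {G :: real ^ 2 ^ 'n. \<forall>i. G $ i \<in> {g. g extreme_point_of polar W}}"
    using bij by (simp add: card_image inj_on_subset[OF bij_is_inj])
  also have "\<dots> = card {g. g extreme_point_of polar W} ^ CARD('n)"
    by (rule card_vec_components_in)
  finally have extreme_points:
    "card {T. T extreme_point_of ?B} = card {g. g extreme_point_of polar W} ^ CARD('n)" .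
  with facets show ?thesis
    using card_extreme_points_polar_polygon[OF v(1)] \<phi>(3) by (simp add: W_def)
qed

end
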